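(* Let $n$ be a positive integer and $r>1$ an integer. There are non-trivial $r$-colorings of $THK(3,n)$ if and only if $(u_{n-1},r)>1$, or $n$ is even and $5\mid r$.
   Context: "Knot" means a knot or link in 3-space. $THK(3,n)$ is the closure of the 3-strand braid $(\sigma_2\sigma_1^{-1})^n\in B_3$. For an integer $r>1$, an $r$-coloring (Fox coloring) of a knot diagram is an assignment of elements of $\mathbb{Z}_r=\mathbb{Z}/r\mathbb{Z}$ to its arcs such that at each crossing $2y-x-z=0$ in $\mathbb{Z}_r$, where $y$ is the color of the over-arc and $x,z$ those of the two under-arcs. It is non-trivial if it uses at least two colors; existence of a non-trivial $r$-coloring does not depend on the diagram. $(a,b)$ denotes the greatest common divisor. The integers $u_n$ ($n\ge 0$) are given by \[ u_n=\frac{1}{\sqrt5}\left[\left(\frac{1+\sqrt5}{2}\right)^{n+2}-\left(\frac{-1+\sqrt5}{2}\right)^{n}-\left(\frac{1-\sqrt5}{2}\right)^{n+2}+\left(\frac{-1-\sqrt5}{2}\right)^{n}\right]. \] *)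

theory Defs
  imports Complex_Main "HOL-Number_Theory.Number_Theory"
begin

section \<open>Fox colorings of link diagrams\<close>

text \<open>
  For colorings only the arcs of a diagram and the incidences at its crossings matter.
  A crossing is a triple (over-arc, under-arc, under-arc).
\<close>

record 'a link_diagram =
  arcs :: "'a set"
  crossings :: "('a \<times> 'a \<times> 'a) set"

text \<open>The elements of $Z_r$ are represented by the integers 0, ..., r - 1.\<close>

definition fox_coloring :: "int \<Rightarrow> 'a link_diagram \<Rightarrow> ('a \<Rightarrow> int) \<Rightarrow> bool" where
  "fox_coloring r D c \<longleftrightarrow>
     (\<forall>a \<in> arcs D. c a \<in> {0..<r}) \<and>
     (\<forall>(y, x, z) \<in> crossings D. [2 * c y - c x - c z = 0] (mod r))"

definition nontrivial_coloring :: "'a link_diagram \<Rightarrow> ('a \<Rightarrow> int) \<Rightarrow> bool" where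
  "nontrivial_coloring D c \<longleftrightarrow> (\<exists>a \<in> arcs D. \<exists>b \<in> arcs D. c a \<noteq> c b)"


section \<open>Diagrams of closed braids\<close>

text \<open>
  A braid on k strands is given by a word in the Artin generators; letters are meant to
  have index i with 1 \<le> i < k.
\<close>

datatype artin_letter = Gen nat | Gen_inv nat

type_synonym braid_word = "artin_letter list"

text \<open>
  The diagram of a braid word w is cut at the levels 0, ..., length w, the letter w ! t
  lying between the levels t and t + 1. The point (t, j) is the one at level t in strand
  position j.
\<close>

type_synonym strand_point = "nat \<times> nat"

definition strand_points :: "nat \<Rightarrow> braid_word \<Rightarrow> strand_point set" where
  "strand_points k w = {0..length w} \<times> {1..k}"

fun letter_index :: "artin_letter \<Rightarrow> nat" where
  "letter_index (Gen i) = i"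
| "letter_index (Gen_inv i) = i"

text \<open>
  At the letter with index i, the strands in positions i and i + 1 cross. For the
  generator itself the strand running from position i to position i + 1 is the
  over-strand, for the inverse it is the under-strand. The functions give the positions
  of the over- and the under-strand before and after the crossing.
\<close>

fun over_strand :: "artin_letter \<Rightarrow> nat \<times> nat" where
  "over_strand (Gen i) = (i, i + 1)"
| "over_strand (Gen_inv i) = (i + 1, i)"

fun under_strand :: "artin_letter \<Rightarrow> nat \<times> nat" where
  "under_strand (Gen i) = (i + 1, i)"
| "under_strand (Gen_inv i) = (i, i + 1)"

text \<open>
  Two points that are joined without passing under a crossing: along a strand not involved
  in the letter, along an over-strand, or along a closing strand.
\<close>

inductive joined :: "nat \<Rightarrow> braid_word \<Rightarrow> strand_point \<Rightarrow> strand_point \<Rightarrow> bool"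
  for k :: nat and w :: braid_word where
  straight: "t < length w \<Longrightarrow> j \<in> {1..k} \<Longrightarrow>
     j \<noteq> letter_index (w ! t) \<Longrightarrow> j \<noteq> letter_index (w ! t) + 1 \<Longrightarrow>
     joined k w (t, j) (t + 1, j)"
| over: "t < length w \<Longrightarrow> over_strand (w ! t) = (a, b) \<Longrightarrow> joined k w (t, a) (t + 1, b)"
| closing: "j \<in> {1..k} \<Longrightarrow> joined k w (length w, j) (0, j)"

text \<open>The equivalence relation on points generated by it; its classes are the arcs.\<close>

definition same_arc :: "nat \<Rightarrow> braid_word \<Rightarrow> (strand_point \<times> strand_point) set" where
  "same_arc k w =
     {(p, q). p \<in> strand_points k w \<and> q \<in> strand_points k w \<and> equivclp (joined k w) p q}"

definition arc_of :: "nat \<Rightarrow> braid_word \<Rightarrow> strand_point \<Rightarrow> strand_point set" where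
  "arc_of k w p = same_arc k w `` {p}"

definition closed_braid :: "nat \<Rightarrow> braid_word \<Rightarrow> strand_point set link_diagram" where
  "closed_braid k w = \<lparr>
     arcs = strand_points k w // same_arc k w,
     crossings =
       {(arc_of k w (t, fst (over_strand (w ! t))),
         arc_of k w (t, fst (under_strand (w ! t))),
         arc_of k w (t + 1, snd (under_strand (w ! t)))) | t. t < length w} \<rparr>"

definition THK3 :: "nat \<Rightarrow> strand_point set link_diagram" where
  "THK3 n = closed_braid 3 (concat (replicate n [Gen 2, Gen_inv 1]))"


section \<open>The integers $u_n$\<close>

definition u_real :: "nat \<Rightarrow> real" where
  "u_real n = 1 / sqrt 5 *
     (((1 + sqrt 5) / 2) ^ (n + 2) - ((- 1 + sqrt 5) / 2) ^ n
      - ((1 - sqrt 5) / 2) ^ (n + 2) + ((- 1 - sqrt 5) / 2) ^ n)"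

text \<open>The values are integral, so that the floor below is only a conversion of types.\<close>

definition u_seq :: "nat \<Rightarrow> int" where
  "u_seq n = \<lfloor>u_real n\<rfloor>"

lemma u_real_fib: "u_real n = of_int (int (fib (n + 2)) + (- 1) ^ n * int (fib n))"
proof -
  let ?p = "(1 + sqrt 5) / 2 :: real" and ?q = "(1 - sqrt 5) / 2 :: real"
  have split: "1 / s * (p ^ (n + 2) - (- q) ^ n - q ^ (n + 2) + (- p) ^ n) =
      (p ^ (n + 2) - q ^ (n + 2)) / s + (- 1) ^ n * ((p ^ n - q ^ n) / s)" for s p q :: real
    unfolding power_minus[of p] power_minus[of q]
    by (simp add: algebra_simps diff_divide_distrib add_divide_distrib)
  have fib: "real (fib m) = (?p ^ m - ?q ^ m) / sqrt 5" for m
    by (rule fib_closed_form)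
  have "(- 1 + sqrt 5) / 2 = - ?q" "(- 1 - sqrt 5) / 2 = - ?p"
    by (simp_all add: field_simps)
  then have "u_real n =
      1 / sqrt 5 * (?p ^ (n + 2) - (- ?q) ^ n - ?q ^ (n + 2) + (- ?p) ^ n)"
    by (simp only: u_real_def)
  also have "\<dots> = (?p ^ (n + 2) - ?q ^ (n + 2)) / sqrt 5
      + (- 1) ^ n * ((?p ^ n - ?q ^ n) / sqrt 5)"
    by (rule split)
  also have "\<dots> = real (fib (n + 2)) + (- 1) ^ n * real (fib n)"
    by (simp only: fib)
  finally show ?thesis by simp
qed

lemma of_int_u_seq: "of_int (u_seq n) = u_real n"
  by (simp add: u_seq_def u_real_fib)

end

theory Submission imports Defs begin

text \<open>
  A colouring of a closed braid is the same as a colouring of the points at which the strands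
  cross the levels. For the braid \<open>(\<sigma>\<^sub>2\<sigma>\<^sub>1\<inverse>)\<^sup>n\<close> the three colours at a level determine those at the
  next level. Subtracting from all colours a suitable constant, one may assume that the colours
  at the first level are \<open>a, a + b, b\<close>, and then the colours met along the braid are exactly the
  terms of the sequence \<open>g\<close> that starts with \<open>b, a\<close> and obeys the Fibonacci recurrence: at the
  crossing with number \<open>t\<close> the over-strand has the colour \<open>g (t + 2)\<close> and the under-strand changes
  from \<open>g t\<close> to \<open>g (t + 3)\<close>, in accordance with \<open>2 g (t + 2) = g t + g (t + 3)\<close>. The braid has
  \<open>2n\<close> letters, so the colouring closes up if and only if \<open>g\<close> has the period \<open>2n\<close> modulo \<open>r\<close>, and it
  is trivial if and only if \<open>g\<close> vanishes modulo \<open>r\<close>. This is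
  \<open>thk_coloring_iff_periodic_fib_like\<close>.

  It remains to decide when a non-zero sequence of this kind with period \<open>2n\<close> exists
  modulo \<open>r\<close> (\<open>periodic_fib_like_iff\<close>). Comparing the terms at distance \<open>n\<close> on both sides of a given one yields (\<open>fib_like_shift\<close>)
  \<open>g (m + 2n) - g m = u\<^bsub>n-1\<^esub> h (m + n)\<close>, where \<open>h = g\<close> for odd \<open>n\<close>, and
  \<open>h j = g (j + 1) + g (j - 1)\<close> for even \<open>n\<close>. If \<open>u\<^bsub>n-1\<^esub>\<close> is a unit modulo \<open>r\<close>, the period
  forces \<open>h\<close> to vanish; for even \<open>n\<close> this leaves room for \<open>g \<noteq> 0\<close> only if \<open>5\<close> divides \<open>r\<close>, as
  \<open>h (j + 1) + h (j - 1) = 5 g j\<close>. Conversely, the Fibonacci numbers multiplied by \<open>r / d\<close> with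
  \<open>d = (u\<^bsub>n-1\<^esub>, r) > 1\<close>, or the Lucas numbers multiplied by \<open>r / 5\<close>, are sequences as required.
\<close>

section \<open>Sequences with the Fibonacci recurrence\<close>

definition fib_like :: "(nat \<Rightarrow> int) \<Rightarrow> bool" where
  "fib_like g \<longleftrightarrow> (\<forall>m. g (m + 2) = g (m + 1) + g m)"

lemma fib_likeD: "fib_like g \<Longrightarrow> g (Suc (Suc m)) = g (Suc m) + g m"
  by (simp add: fib_like_def)

lemma fib_like_fib: "fib_like (\<lambda>m. int (fib m))"
  by (simp add: fib_like_def)

lemma fib_like_scale: "fib_like g \<Longrightarrow> fib_like (\<lambda>m. c * g m)"
  by (simp add: fib_like_def algebra_simps)

lemma ex_fib_like: "\<exists>g. fib_like g \<and> g 0 = b \<and> g 1 = a"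
  by (rule exI[of _ "\<lambda>m. int (fib m) * (a - b) + int (fib (Suc m)) * b"])
     (simp add: fib_like_def algebra_simps)

lemma fib_like_eq:
  assumes "fib_like s"
  shows "s (Suc k) = int (fib (Suc k)) * s 1 + int (fib k) * s 0"
proof (induction k rule: fib.induct)
  case (3 k)
  then show ?case
    using fib_likeD[OF assms, of "Suc k"] by (simp add: algebra_simps)
qed (use fib_likeD[OF assms, of 0] in simp_all)

lemma fib_like_cong_zero:
  assumes "fib_like g" "r dvd g 0" "r dvd g 1"
  shows "r dvd g m"
  using assms(2,3) fib_like_eq[OF assms(1), of "m - 1"] by (cases m) simp_all

text \<open>
  The reflected sequence \<open>k \<mapsto> (-1)\<^sup>k g (j - k)\<close> obeys the Fibonacci recurrence as well, hence so do
  its sum and its difference with \<open>k \<mapsto> g (j + k)\<close>. These are thus determined by their terms at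
  \<open>k = 0\<close> and \<open>k = 1\<close>, namely \<open>2 g j, g j\<close> and \<open>0, g (j + 1) + g (j - 1)\<close>. As \<open>g\<close> starts at \<open>0\<close>,
  the reflection is only available for \<open>k \<le> j\<close>.
\<close>

lemma fib_like_reflect:
  assumes "fib_like g"
  shows "Suc k \<le> j \<Longrightarrow> g (j + Suc k) + (- 1) ^ Suc k * g (j - Suc k) =
           (int (fib (Suc k)) + 2 * int (fib k)) * g j" (is "_ \<Longrightarrow> ?S k")
    and "Suc k \<le> j \<Longrightarrow> g (j + Suc k) - (- 1) ^ Suc k * g (j - Suc k) =
           int (fib (Suc k)) * (g (j + 1) + g (j - 1))" (is "_ \<Longrightarrow> ?D k")
proof -
  have step: "g (j - k) = g (j - Suc k) + g (j - Suc (Suc k))" if "Suc (Suc k) \<le> j" for k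
  proof -
    have "j - k = Suc (Suc (j - Suc (Suc k)))" "j - Suc k = Suc (j - Suc (Suc k))"
      using that by simp_all
    then show ?thesis using fib_likeD[OF assms, of "j - Suc (Suc k)"] by simp
  qed
  have "Suc k \<le> j \<longrightarrow> ?S k \<and> ?D k"
  proof (induction k rule: fib.induct)
    case 1
    show ?case
    proof
      assume "Suc 0 \<le> j"
      then obtain i where "j = Suc i" by (cases j) auto
      then show "?S 0 \<and> ?D 0" using fib_likeD[OF assms, of i] by simp
    qed
  next
    case 2
    show ?case
    proof
      assume "Suc (Suc 0) \<le> j"
      then have "g j = g (j - 1) + g (j - 2)" "g (Suc j) = g j + g (j - 1)"
        using step[of 0] fib_likeD[OF assms, of "j - 1"] by (simp_all add: eval_nat_numeral)
      then show "?S (Suc 0) \<and> ?D (Suc 0)"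
        using fib_likeD[OF assms, of j] by (simp add: eval_nat_numeral)
    qed
  next
    case (3 k)
    show ?case
    proof
      assume le: "Suc (Suc (Suc k)) \<le> j"
      have right: "g (j + Suc (Suc (Suc k))) = g (j + Suc (Suc k)) + g (j + Suc k)"
        using fib_likeD[OF assms, of "j + Suc k"] by simp
      have left: "g (j - Suc k) = g (j - Suc (Suc k)) + g (j - Suc (Suc (Suc k)))"
        using step[OF le] .
      have fib: "int (fib (Suc (Suc (Suc k)))) = int (fib (Suc (Suc k))) + int (fib (Suc k))"
        "int (fib (Suc (Suc k))) = int (fib (Suc k)) + int (fib k)" by simp_all
      have IH: "?S (Suc k)" "?D (Suc k)" "?S k" "?D k" using 3 le by simp_all
      have "g (j + Suc (Suc (Suc k))) + (- 1) ^ Suc (Suc (Suc k)) * g (j - Suc (Suc (Suc k))) =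
          (g (j + Suc (Suc k)) + (- 1) ^ Suc (Suc k) * g (j - Suc (Suc k))) +
          (g (j + Suc k) + (- 1) ^ Suc k * g (j - Suc k))"
        unfolding right left by (simp add: ring_distribs)
      also have "\<dots> = (int (fib (Suc (Suc (Suc k)))) + 2 * int (fib (Suc (Suc k)))) * g j"
        unfolding IH fib by (simp only: ring_distribs ac_simps)
      finally have S: "?S (Suc (Suc k))" .
      have "g (j + Suc (Suc (Suc k))) - (- 1) ^ Suc (Suc (Suc k)) * g (j - Suc (Suc (Suc k))) =
          (g (j + Suc (Suc k)) - (- 1) ^ Suc (Suc k) * g (j - Suc (Suc k))) +
          (g (j + Suc k) - (- 1) ^ Suc k * g (j - Suc k))"
        unfolding right left by (simp add: ring_distribs)
      also have "\<dots> = int (fib (Suc (Suc (Suc k)))) * (g (j + 1) + g (j - 1))"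
        unfolding IH fib(1) by (simp only: ring_distribs)
      finally have D: "?D (Suc (Suc k))" .
      from S D show "?S (Suc (Suc k)) \<and> ?D (Suc (Suc k))" ..
    qed
  qed
  then show "Suc k \<le> j \<Longrightarrow> ?S k" "Suc k \<le> j \<Longrightarrow> ?D k" by auto
qed

lemma u_seq_fib: "u_seq n = int (fib (n + 2)) + (- 1) ^ n * int (fib n)"
  using of_int_u_seq[of n] unfolding u_real_fib of_int_eq_iff .

text \<open>
  For odd \<open>n\<close> the number \<open>u\<^bsub>n-1\<^esub>\<close> is the Lucas number \<open>L\<^sub>n = F\<^sub>n + 2 F\<^bsub>n-1\<^esub>\<close>, for even \<open>n\<close> it is the
  Fibonacci number \<open>F\<^sub>n\<close>. These are the factors that arise when the sequence is reflected at the
  middle \<open>m + n\<close> of the shift.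
\<close>

lemma fib_like_shift:
  assumes "fib_like g" "n > 0"
  shows "g (m + 2 * n) - g m =
    u_seq (n - 1) * (if odd n then g (m + n) else g (m + n + 1) + g (m + n - 1))"
proof -
  obtain k where n: "n = Suc k" using assms(2) by (cases n) auto
  have idx: "m + 2 * n = m + n + Suc k" "m + n - Suc k = m" using n by simp_all
  show ?thesis
    using fib_like_reflect[OF assms(1), of k "m + n"] n
    unfolding idx u_seq_fib by (cases "even k") (simp_all add: algebra_simps)
qed

text \<open>
  The exceptional prime \<open>5\<close> enters because \<open>g \<mapsto> h\<close> with \<open>h j = g (j + 1) + g (j - 1)\<close>, which takes
  the Fibonacci numbers to the Lucas numbers, is multiplication by \<open>5\<close> when it is applied twice.
  Hence it is injective modulo \<open>r\<close> if \<open>5\<close> does not divide \<open>r\<close>, whereas modulo \<open>5\<close> it sends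
  the Lucas numbers to zero.
\<close>

lemma periodic_fib_like_iff:
  fixes r :: int
  assumes "n > 0" "r > 1"
  shows "(\<exists>g. fib_like g \<and> (\<forall>m. [g (m + 2 * n) = g m] (mod r)) \<and> (\<exists>m. \<not> r dvd g m)) \<longleftrightarrow>
         gcd (u_seq (n - 1)) r > 1 \<or> (even n \<and> 5 dvd r)"
proof
  assume "\<exists>g. fib_like g \<and> (\<forall>m. [g (m + 2 * n) = g m] (mod r)) \<and> (\<exists>m. \<not> r dvd g m)"
  then obtain g m where g: "fib_like g" and per: "\<And>m. [g (m + 2 * n) = g m] (mod r)"
    and m: "\<not> r dvd g m" by blast
  show "gcd (u_seq (n - 1)) r > 1 \<or> (even n \<and> 5 dvd r)"
  proof (rule ccontr)
    assume not: "\<not> ?thesis"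
    have "gcd (u_seq (n - 1)) r > 0" using assms(2) by (simp add: gcd_pos_int)
    then have "gcd (u_seq (n - 1)) r = 1" using not by linarith
    then have cop: "coprime r (u_seq (n - 1))"
      by (simp add: coprime_iff_gcd_eq_1 gcd.commute)
    have van: "r dvd (if odd n then g (i + n) else g (i + n + 1) + g (i + n - 1))" for i
    proof -
      have "r dvd g (i + 2 * n) - g i" using per[of i] by (simp add: cong_iff_dvd_diff)
      then show ?thesis
        unfolding fib_like_shift[OF g assms(1)] using cop by (simp only: coprime_dvd_mult_right_iff)
    qed
    \<comment> \<open>Moving \<open>m\<close> by one period makes room for its neighbours on the left.\<close>
    have "r dvd g (m + 2 * n)"
    proof (cases "odd n")
      case True
      then show ?thesis using van[of "m + n"] by (simp add: mult_2 add.assoc)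
    next
      case False
      define j where "j = m + 2 * n - 2"
      have j: "m + 2 * n = j + 2" using assms(1) by (simp add: j_def)
      have idx: "m + n - 1 + n + 1 = j + 2" "m + n - 1 + n - 1 = j"
        "m + n + 1 + n + 1 = j + 4" "m + n + 1 + n - 1 = j + 2"
        using j assms(1) by simp_all
      have "r dvd g (j + 2) + g j"
        using van[of "m + n - 1"] False unfolding idx by simp
      moreover have "r dvd g (j + 4) + g (j + 2)"
        using van[of "m + n + 1"] False unfolding idx by simp
      ultimately have "r dvd (g (j + 4) + g (j + 2)) + (g (j + 2) + g j)"
        by (rule dvd_add[rotated])
      also have "\<dots> = 5 * g (j + 2)"
        using fib_likeD[OF g, of j] fib_likeD[OF g, of "j + 1"] fib_likeD[OF g, of "j + 2"]
        by (simp add: eval_nat_numeral)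
      finally have "r dvd 5 * g (j + 2)" .
      moreover have "\<not> 5 dvd r" using not False by blast
      then have "coprime r 5"
        using prime_imp_coprime[of "5::int" r] by (simp add: coprime_commute)
      ultimately show ?thesis unfolding j by (simp only: coprime_dvd_mult_right_iff)
    qed
    then show False using per[of m] m by (simp add: cong_dvd_iff)
  qed
next
  assume rhs: "gcd (u_seq (n - 1)) r > 1 \<or> (even n \<and> 5 dvd r)"
  have proper: "\<not> r dvd r div d" if "d > 1" "d dvd r" for d :: int
  proof
    assume "r dvd r div d"
    moreover have "r div d > 0" "r div d < r"
      using that assms(2) by (auto simp: pos_imp_zdiv_pos_iff zdvd_imp_le int_div_less_self)
    ultimately show False using zdvd_imp_le by fastforce
  qed
  \<comment> \<open>A sequence with the period \<open>2n\<close> modulo a divisor \<open>d\<close> of \<open>r\<close> has this period modulo \<open>r\<close> after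
    multiplication by \<open>r / d\<close>.\<close>
  have witness: "\<exists>g. fib_like g \<and> (\<forall>m. [g (m + 2 * n) = g m] (mod r)) \<and> (\<exists>m. \<not> r dvd g m)"
    if "fib_like h" "h 1 = 1" "d > 1" "d dvd r" "\<And>m. d dvd h (m + 2 * n) - h m" for h d
  proof (intro exI conjI allI)
    show "fib_like (\<lambda>m. r div d * h m)" using that(1) by (rule fib_like_scale)
    show "\<not> r dvd r div d * h 1" using proper[OF that(3,4)] that(2) by simp
    show "[r div d * h (m + 2 * n) = r div d * h m] (mod r)" for m
    proof -
      have "r div d * d dvd r div d * (h (m + 2 * n) - h m)"
        using that(5) by (rule mult_dvd_mono[OF dvd_refl])
      then show ?thesis using that(4) by (simp add: cong_iff_dvd_diff algebra_simps)
    qed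
  qed
  from rhs show "\<exists>g. fib_like g \<and> (\<forall>m. [g (m + 2 * n) = g m] (mod r)) \<and> (\<exists>m. \<not> r dvd g m)"
  proof
    assume "gcd (u_seq (n - 1)) r > 1"
    then show ?thesis
    proof (intro witness[of "\<lambda>m. int (fib m)" "gcd (u_seq (n - 1)) r"] fib_like_fib)
      show "gcd (u_seq (n - 1)) r dvd int (fib (m + 2 * n)) - int (fib m)" for m
        unfolding fib_like_shift[OF fib_like_fib assms(1)] by (intro dvd_mult2 gcd_dvd1)
    qed simp_all
  next
    assume n5: "even n \<and> 5 dvd r"
    obtain L where L: "fib_like L" "L 0 = 2" "L 1 = 1" using ex_fib_like by blast
    have five: "L (i + 2) + L i = 5 * int (fib (i + 1))" for i
    proof (induction i rule: fib.induct)
      case (3 i)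
      then show ?case
        using fib_likeD[OF L(1), of i] fib_likeD[OF L(1), of "Suc (Suc i)"] by simp
    qed (use L fib_likeD[OF L(1), of 0] fib_likeD[OF L(1), of 1] in simp_all)
    show ?thesis
    proof (rule witness[of L 5])
      show "5 dvd L (m + 2 * n) - L m" for m
      proof -
        have "m + n + 1 = (m + n - 1) + 2" using assms(1) by simp
        then have "5 dvd L (m + n + 1) + L (m + n - 1)" using five[of "m + n - 1"] by simp
        then show ?thesis
          unfolding fib_like_shift[OF L(1) assms(1)] using n5 by simp
      qed
    qed (use L n5 in simp_all)
  qed
qed


section \<open>Colorings of the points of a closed braid\<close>

definition point_coloring :: "int \<Rightarrow> nat \<Rightarrow> braid_word \<Rightarrow> (strand_point \<Rightarrow> int) \<Rightarrow> bool" where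
  "point_coloring r k w f \<longleftrightarrow>
     (\<forall>p \<in> strand_points k w. f p \<in> {0..<r}) \<and>
     (\<forall>p q. joined k w p q \<longrightarrow> f p = f q) \<and>
     (\<forall>t < length w. [2 * f (t, fst (over_strand (w ! t))) - f (t, fst (under_strand (w ! t)))
        - f (t + 1, snd (under_strand (w ! t))) = 0] (mod r))"

lemma equiv_same_arc: "equiv (strand_points k w) (same_arc k w)"
  by (rule equivI)
     (auto simp: same_arc_def refl_on_def sym_def trans_def
       intro: equivclp_sym equivclp_trans)

lemma over_under_in_range:
  assumes "letter_index a \<in> {1..<k}"
  shows "fst (over_strand a) \<in> {1..k}" "snd (over_strand a) \<in> {1..k}"
    "fst (under_strand a) \<in> {1..k}" "snd (under_strand a) \<in> {1..k}"
  using assms by (cases a; simp)+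

lemma joined_in_strand_points:
  assumes "\<forall>a \<in> set w. letter_index a \<in> {1..<k}" "joined k w p q"
  shows "p \<in> strand_points k w" "q \<in> strand_points k w"
  using assms(2)
proof (induction rule: joined.induct)
  case (over t a b)
  {
    case 1
    show ?case
      using over over_under_in_range(1)[of "w ! t" k] assms(1) by (simp add: strand_points_def)
  next
    case 2
    show ?case
      using over over_under_in_range(2)[of "w ! t" k] assms(1) by (simp add: strand_points_def)
  }
qed (auto simp: strand_points_def)

text \<open>
  A colouring of the points is constant on arcs, since these are the classes of the equivalence
  relation generated by \<open>joined\<close>. Without the condition on the letters, points outside the diagram
  could be joined to points of it.
\<close>

lemma ex_nontrivial_coloring_iff:
  assumes w: "\<forall>a \<in> set w. letter_index a \<in> {1..<k}"
  shows "(\<exists>c. fox_coloring r (closed_braid k w) c \<and> nontrivial_coloring (closed_braid k w) c) \<longleftrightarrow>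
    (\<exists>f. point_coloring r k w f \<and> (\<exists>p \<in> strand_points k w. \<exists>q \<in> strand_points k w. f p \<noteq> f q))"
    (is "?L \<longleftrightarrow> ?R")
proof
  have arcs: "arcs (closed_braid k w) = arc_of k w ` strand_points k w"
    by (auto simp: closed_braid_def quotient_def arc_of_def)
  have mem: "(t, fst (over_strand (w ! t))) \<in> strand_points k w"
    "(t, fst (under_strand (w ! t))) \<in> strand_points k w"
    "(Suc t, snd (under_strand (w ! t))) \<in> strand_points k w" if "t < length w" for t
    using that over_under_in_range[of "w ! t" k] w by (simp_all add: strand_points_def)
  {
    assume ?L
    then obtain c where c: "fox_coloring r (closed_braid k w) c"
      and nt: "nontrivial_coloring (closed_braid k w) c" by blast
    have "point_coloring r k w (\<lambda>p. c (arc_of k w p))"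
      unfolding point_coloring_def
    proof (intro conjI ballI allI impI)
      show "c (arc_of k w p) \<in> {0..<r}" if "p \<in> strand_points k w" for p
        using c that by (auto simp: fox_coloring_def arcs)
      show "c (arc_of k w p) = c (arc_of k w q)" if "joined k w p q" for p q
      proof -
        have "(p, q) \<in> same_arc k w"
          using joined_in_strand_points[OF w that] that by (auto simp: same_arc_def)
        then show ?thesis
          unfolding arc_of_def by (simp add: equiv_class_eq[OF equiv_same_arc])
      qed
      show "[2 * c (arc_of k w (t, fst (over_strand (w ! t))))
          - c (arc_of k w (t, fst (under_strand (w ! t))))
          - c (arc_of k w (t + 1, snd (under_strand (w ! t)))) = 0] (mod r)"
        if "t < length w" for t
      proof -
        have "(arc_of k w (t, fst (over_strand (w ! t))), arc_of k w (t, fst (under_strand (w ! t))),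
            arc_of k w (t + 1, snd (under_strand (w ! t)))) \<in> crossings (closed_braid k w)"
          using that by (auto simp: closed_braid_def)
        then show ?thesis using c by (auto simp: fox_coloring_def)
      qed
    qed
    moreover have "\<exists>p \<in> strand_points k w. \<exists>q \<in> strand_points k w.
        c (arc_of k w p) \<noteq> c (arc_of k w q)"
      using nt by (auto simp: nontrivial_coloring_def arcs)
    ultimately show ?R by blast
  next
    assume ?R
    then obtain f p q where f: "point_coloring r k w f"
      and pq: "p \<in> strand_points k w" "q \<in> strand_points k w" "f p \<noteq> f q" by blast
    have inv: "f x = f y" if "equivclp (joined k w) x y" for x y
      using that by (induction rule: equivclp_induct) (use f in \<open>auto simp: point_coloring_def\<close>)
    define c where "c A = the_elem (f ` A)" for A
    have c: "c (arc_of k w x) = f x" if "x \<in> strand_points k w" for x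
    proof -
      have "f y = f x" if "y \<in> arc_of k w x" for y
        using that inv[of x y] by (simp add: arc_of_def same_arc_def)
      moreover have "x \<in> arc_of k w x"
        using that by (simp add: arc_of_def same_arc_def)
      ultimately have "f ` arc_of k w x = {f x}" by blast
      then show ?thesis by (simp add: c_def)
    qed
    have "fox_coloring r (closed_braid k w) c"
      using f mem by (auto simp: fox_coloring_def arcs c point_coloring_def)
        (auto simp: closed_braid_def c)
    moreover have "nontrivial_coloring (closed_braid k w) c"
      using pq c by (auto simp: nontrivial_coloring_def arcs)
    ultimately show ?L by blast
  }
qed


section \<open>The braid of THK(3,n)\<close>

definition thk_word :: "nat \<Rightarrow> braid_word" where
  "thk_word n = concat (replicate n [Gen 2, Gen_inv 1])"

lemma length_thk_word: "length (thk_word n) = 2 * n"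
  by (induction n) (simp_all add: thk_word_def)

lemma thk_word_nth: "t < 2 * n \<Longrightarrow> thk_word n ! t = (if even t then Gen 2 else Gen_inv 1)"
proof (induction n arbitrary: t)
  case (Suc n)
  then show ?case by (cases t rule: fib.cases) (auto simp: thk_word_def)
qed simp

text \<open>
  At level \<open>t\<close> the three points have the colours \<open>g t\<close>, \<open>g (t + 1)\<close>, \<open>g (t + 2)\<close> in some order, and
  \<open>term_index t j\<close> is the index of the colour in position \<open>j\<close>. The next crossing always has its
  over-strand in the middle position, which has the colour \<open>g (t + 2)\<close>; its under-strand, of colour
  \<open>g t\<close>, comes from the right for even \<open>t\<close> and from the left for odd \<open>t\<close>.
\<close>

definition term_index :: "nat \<Rightarrow> nat \<Rightarrow> nat" where
  "term_index t j = (if j = 2 then t + 2 else if even t \<longleftrightarrow> j = 1 then t + 1 else t)"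

lemma point_coloring_thk_iff:
  "point_coloring r 3 (thk_word n) f \<longleftrightarrow>
     (\<forall>t \<le> 2 * n. \<forall>j \<in> {1..3}. f (t, j) \<in> {0..<r}) \<and>
     (\<forall>t < 2 * n. if even t
        then f (t, 1) = f (t + 1, 1) \<and> f (t, 2) = f (t + 1, 3) \<and>
          [2 * f (t, 2) - f (t, 3) - f (t + 1, 2) = 0] (mod r)
        else f (t, 3) = f (t + 1, 3) \<and> f (t, 2) = f (t + 1, 1) \<and>
          [2 * f (t, 2) - f (t, 1) - f (t + 1, 2) = 0] (mod r)) \<and>
     (\<forall>j \<in> {1..3}. f (2 * n, j) = f (0, j))"
    (is "?L \<longleftrightarrow> ?range \<and> (\<forall>t < 2 * n. ?cross t) \<and> ?close")
proof
  assume L: ?L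
  note joined = joined.intros[where k = 3 and w = "thk_word n", unfolded length_thk_word]
  have eq: "f p = f q" if "joined 3 (thk_word n) p q" for p q
    using L that unfolding point_coloring_def by blast
  have "?cross t" if t: "t < 2 * n" for t
  proof -
    have cross: "[2 * f (t, fst (over_strand (thk_word n ! t)))
        - f (t, fst (under_strand (thk_word n ! t)))
        - f (t + 1, snd (under_strand (thk_word n ! t))) = 0] (mod r)"
      using L t by (simp add: point_coloring_def length_thk_word)
    show ?thesis
      using cross eq[OF joined(2)[OF t]] eq[OF joined(1)[OF t, of 1]] eq[OF joined(1)[OF t, of 3]]
      by (simp add: thk_word_nth[OF t] numeral_2_eq_2[symmetric] split: if_splits)
  qed
  moreover have ?range
    using L by (simp add: point_coloring_def length_thk_word strand_points_def)
  moreover have ?close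
    using eq[OF joined(3)] by blast
  ultimately show "?range \<and> (\<forall>t < 2 * n. ?cross t) \<and> ?close" by blast
next
  assume R: "?range \<and> (\<forall>t < 2 * n. ?cross t) \<and> ?close"
  have "f p = f q" if "joined 3 (thk_word n) p q" for p q
    using that
  proof cases
    case (straight t j)
    then have "t < 2 * n" "j = 1 \<or> j = 2 \<or> j = 3" by (auto simp: length_thk_word)
    moreover from this have "?cross t" using R by blast
    ultimately show ?thesis
      using straight(1,2,5,6) by (auto simp: thk_word_nth split: if_splits)
  next
    case (over t a b)
    then have "t < 2 * n" by (simp add: length_thk_word)
    moreover from this have "?cross t" using R by blast
    ultimately show ?thesis
      using over by (auto simp: thk_word_nth numeral_2_eq_2[symmetric] split: if_splits)
  next
    case (closing j)
    then show ?thesis using R by (simp add: length_thk_word)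
  qed
  then show ?L
    using R by (auto simp: point_coloring_def length_thk_word strand_points_def thk_word_nth
      numeral_2_eq_2[symmetric] split: if_splits)
qed

text \<open>
  Any three colours at the first level have the form \<open>g 1 + c\<close>, \<open>g 2 + c\<close>, \<open>g 0 + c\<close> with
  \<open>g 2 = g 1 + g 0\<close>. This form persists, because the colours at a level and the crossing relation
  determine the colours at the next level.
\<close>

lemma point_coloring_is_fib_like:
  assumes f: "point_coloring r 3 (thk_word n) f"
  obtains g c where "fib_like g"
    "\<And>t j. t \<le> 2 * n \<Longrightarrow> j \<in> {1..3} \<Longrightarrow> [f (t, j) = g (term_index t j) + c] (mod r)"
proof -
  have pos: "j = 1 \<or> j = 2 \<or> j = 3" if "j \<in> {1..3}" for j :: nat
    using that by auto
  \<comment> \<open>The equation \<open>g 1 - g 2 + g 0 = 0\<close> leaves only this choice.\<close>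
  define c where "c = f (0, 1) - f (0, 2) + f (0, 3)"
  obtain g where g: "fib_like g" "g 0 = f (0, 3) - c" "g 1 = f (0, 1) - c"
    using ex_fib_like by blast
  have "\<forall>j \<in> {1..3}. [f (t, j) = g (term_index t j) + c] (mod r)" if "t \<le> 2 * n" for t
    using that
  proof (induction t)
    case 0
    have "g 2 = f (0, 2) - c"
      using fib_likeD[OF g(1), of 0] g by (simp add: c_def eval_nat_numeral)
    then have "f (0, j) = g (term_index 0 j) + c" if "j = 1 \<or> j = 2 \<or> j = 3" for j
      using that g by (auto simp: term_index_def eval_nat_numeral)
    then show ?case using pos by simp
  next
    case (Suc t)
    then have IH: "[f (t, 1) = g (term_index t 1) + c] (mod r)"
      "[f (t, 2) = g (term_index t 2) + c] (mod r)"
      "[f (t, 3) = g (term_index t 3) + c] (mod r)" and t: "t < 2 * n" by auto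
    have g3: "g (Suc t + 2) = 2 * g (t + 2) - g t"
      using fib_likeD[OF g(1), of t] fib_likeD[OF g(1), of "Suc t"] by simp
    note R = f[unfolded point_coloring_thk_iff, THEN conjunct2, THEN conjunct1, rule_format, OF t]
    have new: "[z = g (Suc t + 2) + c] (mod r)"
      if "[2 * y - x - z = 0] (mod r)" "[y = g (t + 2) + c] (mod r)" "[x = g t + c] (mod r)"
      for x y z
    proof -
      have "r dvd 2 * y - x - z" "r dvd y - (g (t + 2) + c)" "r dvd x - (g t + c)"
        using that by (simp_all add: cong_iff_dvd_diff)
      then have "r dvd 2 * (y - (g (t + 2) + c)) - (x - (g t + c)) - (2 * y - x - z)"
        by (meson dvd_diff dvd_mult)
      also have "\<dots> = z - (g (Suc t + 2) + c)" unfolding g3 by (simp add: algebra_simps)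
      finally show ?thesis by (simp add: cong_iff_dvd_diff)
    qed
    have "[f (Suc t, 1) = g (term_index (Suc t) 1) + c] (mod r)"
      "[f (Suc t, 2) = g (term_index (Suc t) 2) + c] (mod r)"
      "[f (Suc t, 3) = g (term_index (Suc t) 3) + c] (mod r)"
      using R IH new[of "f (t, 2)" "f (t, 3)" "f (t + 1, 2)"]
        new[of "f (t, 2)" "f (t, 1)" "f (t + 1, 2)"]
      by (auto simp: term_index_def split: if_splits)
    then show ?case using pos by blast
  qed
  with g(1) that show ?thesis by blast
qed

lemma fib_like_periodic:
  assumes "fib_like g" "[g N = g 0] (mod r)" "[g (N + 1) = g 1] (mod r)"
  shows "[g (m + N) = g m] (mod r)"
proof -
  have "fib_like (\<lambda>m. g (m + N) - g m)" using assms(1) by (simp add: fib_like_def)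
  then have "r dvd g (m + N) - g m"
    by (rule fib_like_cong_zero) (use assms in \<open>simp_all add: cong_iff_dvd_diff\<close>)
  then show ?thesis by (simp add: cong_iff_dvd_diff)
qed

lemma thk_coloring_iff_periodic_fib_like:
  assumes "r > 0"
  shows "(\<exists>c. fox_coloring r (THK3 n) c \<and> nontrivial_coloring (THK3 n) c) \<longleftrightarrow>
    (\<exists>g. fib_like g \<and> (\<forall>m. [g (m + 2 * n) = g m] (mod r)) \<and> (\<exists>m. \<not> r dvd g m))"
proof -
  let ?P = "strand_points 3 (thk_word n)"
  have P: "?P = {0..2 * n} \<times> {1..3}" by (simp add: strand_points_def length_thk_word)
  have w: "\<forall>a \<in> set (thk_word n). letter_index a \<in> {1..<3}" by (auto simp: thk_word_def)
  show ?thesis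
    unfolding THK3_def thk_word_def[symmetric] ex_nontrivial_coloring_iff[OF w]
  proof
    assume "\<exists>f. point_coloring r 3 (thk_word n) f \<and> (\<exists>p \<in> ?P. \<exists>q \<in> ?P. f p \<noteq> f q)"
    then obtain f p q where f: "point_coloring r 3 (thk_word n) f"
      and pq: "p \<in> ?P" "q \<in> ?P" "f p \<noteq> f q" by blast
    obtain g c where g: "fib_like g"
      and fg: "\<And>t j. t \<le> 2 * n \<Longrightarrow> j \<in> {1..3} \<Longrightarrow> [f (t, j) = g (term_index t j) + c] (mod r)"
      using point_coloring_is_fib_like[OF f] by blast
    have close: "[g (term_index (2 * n) j) = g (term_index 0 j)] (mod r)" if "j \<in> {1..3}" for j
    proof -
      have "f (2 * n, j) = f (0, j)"
        using f that by (simp add: point_coloring_thk_iff)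
      then have "[g (term_index (2 * n) j) + c = g (term_index 0 j) + c] (mod r)"
        using fg[of "2 * n" j] fg[of 0 j] that by (metis cong_sym cong_trans order_refl zero_le)
      then show ?thesis by (simp add: cong_add_rcancel)
    qed
    have "[g (m + 2 * n) = g m] (mod r)" for m
      by (rule fib_like_periodic[OF g]) (use close[of 3] close[of 1] in \<open>simp_all add: term_index_def\<close>)
    moreover have "\<exists>m. \<not> r dvd g m"
    proof (rule ccontr)
      assume "\<nexists>m. \<not> r dvd g m"
      then have "[g m + c = c] (mod r)" for m by (simp add: cong_iff_dvd_diff)
      then have "[f x = c] (mod r)" if "x \<in> ?P" for x
        using fg that unfolding P by (cases x) (auto intro: cong_trans)
      then have "[f p = f q] (mod r)"
        using pq by (meson cong_sym cong_trans)
      moreover have "f p \<in> {0..<r}" "f q \<in> {0..<r}"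
        using f pq by (auto simp: point_coloring_def)
      ultimately show False using pq(3) by (simp add: cong_def)
    qed
    ultimately show "\<exists>g. fib_like g \<and> (\<forall>m. [g (m + 2 * n) = g m] (mod r)) \<and> (\<exists>m. \<not> r dvd g m)"
      using g by blast
  next
    assume "\<exists>g. fib_like g \<and> (\<forall>m. [g (m + 2 * n) = g m] (mod r)) \<and> (\<exists>m. \<not> r dvd g m)"
    then obtain g m where g: "fib_like g" and per: "\<And>m. [g (m + 2 * n) = g m] (mod r)"
      and m: "\<not> r dvd g m" by blast
    define f where "f = (\<lambda>(t, j). g (term_index t j) mod r)"
    have shift: "term_index (2 * n) j = term_index 0 j + 2 * n" for j
      by (simp add: term_index_def)
    have g3: "2 * g (t + 2) - g t - g (Suc t + 2) = 0" for t
      using fib_likeD[OF g, of t] fib_likeD[OF g, of "Suc t"] by simp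
    have cross: "[2 * (g (t + 2) mod r) - g t mod r - g (Suc t + 2) mod r = 0] (mod r)" for t
    proof -
      have "[2 * (g (t + 2) mod r) - g t mod r - g (Suc t + 2) mod r
          = 2 * g (t + 2) - g t - g (Suc t + 2)] (mod r)"
        by (intro cong_diff cong_mult cong_refl) (simp_all add: cong_def)
      then show ?thesis unfolding g3 .
    qed
    have "point_coloring r 3 (thk_word n) f"
      unfolding point_coloring_thk_iff
    proof (intro conjI allI ballI impI)
      show "f (2 * n, j) = f (0, j)" for j
        using per[of "term_index 0 j"] by (simp add: f_def shift cong_def)
    qed (use assms cross in \<open>auto simp: f_def term_index_def\<close>)
    moreover have "\<exists>p \<in> ?P. \<exists>q \<in> ?P. f p \<noteq> f q"
    proof (rule ccontr)
      assume "\<not> ?thesis"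
      then have "f (0, 1) = f (0, 2)" "f (0, 3) = f (0, 2)" unfolding P by auto
      then have "r dvd g 2 - g 1" "r dvd g 2 - g 0"
        by (auto simp: f_def term_index_def mod_eq_dvd_iff dvd_diff_commute numeral_2_eq_2)
      then have "r dvd g 0" "r dvd g 1"
        using fib_likeD[OF g, of 0] by (simp_all add: eval_nat_numeral)
      then show False using fib_like_cong_zero[OF g] m by blast
    qed
    ultimately show "\<exists>f. point_coloring r 3 (thk_word n) f \<and> (\<exists>p \<in> ?P. \<exists>q \<in> ?P. f p \<noteq> f q)"
      by blast
  qed
qed

theorem corollary1p2:
  fixes n :: nat and r :: int
  assumes "n > 0" and "r > 1"
  shows "(\<exists>c. fox_coloring r (THK3 n) c \<and> nontrivial_coloring (THK3 n) c) \<longleftrightarrow>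
         gcd (u_seq (n - 1)) r > 1 \<or> (even n \<and> 5 dvd r)"
  using thk_coloring_iff_periodic_fib_like[of r n] periodic_fib_like_iff[OF assms] assms(2)
  by simp

end
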